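(* Let $h_1,h_2:\Omega\to\mathbb R$ be first integrals having transversal intersections of a vector field $F$ defined on an open set $\Omega\subset\mathbb R^3$. Let $w_0\in\Omega$ and let $\mathcal L^1_{w_0}$, $\mathcal L^2_{w_0}$ be the level surfaces of $h_1$, $h_2$ containing $w_0$. Then for each $w_1\in\mathcal L^1_{w_0}\cap\mathcal L^2_{w_0}$ there exists an open interval $I\subset\mathbb R$ containing $0$ such that $$\{\Phi_t(w_1)\,:\,t\in I\}\subset\mathcal L^1_{w_0}\cap\mathcal L^2_{w_0},$$ where $\Phi_t(\cdot)$ is the flow of $F$.
   Context: A first integral of a vector field $F$ is a differentiable function $h$ with $\langle\nabla h,F\rangle=0$. The flow $\Phi_t$ is the local flow of $F$: $t\mapsto\Phi_t(w_1)$ is the integral curve of $F$ with $\Phi_0(w_1)=w_1$. Two differentiable functions $h_1,h_2:\Omega\to\mathbb R$ on an open set $\Omega\subset\mathbb R^3$ have transversal intersections if for every pair of level surfaces $S_1=h_1^{-1}(c_1)$, $S_2=h_2^{-1}(c_2)$ with $S_1\cap S_2\neq\emptyset$, $S_1$ and $S_2$ intersect transversally. *)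

theory Defs
  imports "HOL-Analysis.Analysis"
begin

definition first_integral ::
    "(real^3) set \<Rightarrow> (real^3 \<Rightarrow> real^3) \<Rightarrow> (real^3 \<Rightarrow> real) \<Rightarrow> bool" where
  "first_integral \<Omega> F h \<longleftrightarrow> (\<forall>x\<in>\<Omega>. \<exists>D. GDERIV h x :> D \<and> D \<bullet> F x = 0)"

definition level_surface :: "(real^3) set \<Rightarrow> (real^3 \<Rightarrow> real) \<Rightarrow> real \<Rightarrow> (real^3) set" where
  "level_surface \<Omega> h c = {x \<in> \<Omega>. h x = c}"

text \<open>
  Tangent vectors are velocities at time 0 of curves in \<open>S\<close> through \<open>p\<close>. Differentiability of
  the curve is asked for at time 0 only. If \<open>h\<close> is merely differentiable on an open set, with
  nonzero gradient at \<open>p\<close>, then this is exactly the orthogonal complement of the gradient, for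
  \<open>S\<close> the level set of \<open>h\<close> through \<open>p\<close>; for a \<open>C\<^sup>1\<close> surface it is the usual tangent plane.
\<close>

definition tangent_space :: "(real^3) set \<Rightarrow> real^3 \<Rightarrow> (real^3) set" where
  "tangent_space S p =
     {v. \<exists>\<gamma> :: real \<Rightarrow> real^3. \<gamma> 0 = p \<and> (\<exists>e>0. \<forall>t. \<bar>t\<bar> < e \<longrightarrow> \<gamma> t \<in> S) \<and>
           (\<gamma> has_vector_derivative v) (at 0)}"

text \<open>
  Both sets must have an actual tangent plane at every common point. Without the dimension
  condition, a critical point such as the vertex of a cone, or a level set with interior, could
  satisfy the spanning condition trivially.
\<close>

definition intersect_transversally :: "(real^3) set \<Rightarrow> (real^3) set \<Rightarrow> bool" where
  "intersect_transversally S\<^sub>1 S\<^sub>2 \<longleftrightarrow>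
     (\<forall>p \<in> S\<^sub>1 \<inter> S\<^sub>2.
        subspace (tangent_space S\<^sub>1 p) \<and> dim (tangent_space S\<^sub>1 p) = 2 \<and>
        subspace (tangent_space S\<^sub>2 p) \<and> dim (tangent_space S\<^sub>2 p) = 2 \<and>
        {u + v | u v. u \<in> tangent_space S\<^sub>1 p \<and> v \<in> tangent_space S\<^sub>2 p} = UNIV)"

definition transversal_intersections ::
    "(real^3) set \<Rightarrow> (real^3 \<Rightarrow> real) \<Rightarrow> (real^3 \<Rightarrow> real) \<Rightarrow> bool" where
  "transversal_intersections \<Omega> h\<^sub>1 h\<^sub>2 \<longleftrightarrow>
     (\<forall>c\<^sub>1 c\<^sub>2. level_surface \<Omega> h\<^sub>1 c\<^sub>1 \<inter> level_surface \<Omega> h\<^sub>2 c\<^sub>2 \<noteq> {} \<longrightarrow>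
        intersect_transversally (level_surface \<Omega> h\<^sub>1 c\<^sub>1) (level_surface \<Omega> h\<^sub>2 c\<^sub>2))"

definition open_interval :: "real set \<Rightarrow> bool" where
  "open_interval I \<longleftrightarrow> open I \<and> is_interval I"

definition integral_curve ::
    "(real^3) set \<Rightarrow> (real^3 \<Rightarrow> real^3) \<Rightarrow> real set \<Rightarrow> (real \<Rightarrow> real^3) \<Rightarrow> bool" where
  "integral_curve \<Omega> F J \<gamma> \<longleftrightarrow>
     (\<forall>t\<in>J. \<gamma> t \<in> \<Omega> \<and> (\<gamma> has_vector_derivative F (\<gamma> t)) (at t))"

text \<open>
  \<open>\<Phi> t w\<close> is meaningful for \<open>t \<in> J w\<close>. Neither uniqueness of integral curves nor maximality of
  the domains \<open>J w\<close> is demanded, so that no regularity of \<open>F\<close> has to be fixed; the maximal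
  flow of a locally Lipschitz vector field is an instance.
\<close>

definition local_flow ::
    "(real^3) set \<Rightarrow> (real^3 \<Rightarrow> real^3) \<Rightarrow> (real^3 \<Rightarrow> real set) \<Rightarrow>
     (real \<Rightarrow> real^3 \<Rightarrow> real^3) \<Rightarrow> bool" where
  "local_flow \<Omega> F J \<Phi> \<longleftrightarrow>
     (\<forall>w\<in>\<Omega>. open_interval (J w) \<and> 0 \<in> J w \<and> \<Phi> 0 w = w \<and>
             integral_curve \<Omega> F (J w) (\<lambda>t. \<Phi> t w))"

end

theory Submission
  imports Defs
begin

text \<open>
  By the chain rule, the derivative of a first integral \<open>h\<close> along an integral curve is the inner
  product of the gradient of \<open>h\<close> with \<open>F\<close>, which vanishes. Hence \<open>h\<close> is constant on every
  integral curve over an interval (\<open>first_integral_constant_on_integral_curve\<close>), and the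
  curve stays in the level surface in which it starts. Applied to both first integrals, this
  keeps the whole orbit of \<open>w\<^sub>1\<close> in the intersection, so the domain \<open>J w\<^sub>1\<close> of the flow line
  serves as the interval \<open>I\<close>.
\<close>

lemma first_integral_derivative_zero_on_integral_curve:
  assumes "first_integral \<Omega> F h" and "integral_curve \<Omega> F J \<gamma>" and "t \<in> J"
  shows "((\<lambda>t. h (\<gamma> t)) has_real_derivative 0) (at t)"
proof -
  have curve: "\<gamma> t \<in> \<Omega>" "(\<gamma> has_derivative (\<lambda>s. s *\<^sub>R F (\<gamma> t))) (at t)"
    using assms(2,3) by (auto simp: integral_curve_def has_vector_derivative_def)
  then obtain D where D: "GDERIV h (\<gamma> t) :> D" "D \<bullet> F (\<gamma> t) = 0"
    using assms(1) by (auto simp: first_integral_def)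
  have "((\<lambda>t. h (\<gamma> t)) has_derivative (\<lambda>s. (s *\<^sub>R F (\<gamma> t)) \<bullet> D)) (at t)"
    by (rule has_derivative_compose[OF curve(2) D(1)[unfolded gderiv_def]])
  then show ?thesis
    using D(2) by (simp add: has_field_derivative_def inner_commute lambda_zero)
qed

lemma first_integral_constant_on_integral_curve:
  assumes "first_integral \<Omega> F h" and "integral_curve \<Omega> F J \<gamma>" and "is_interval J"
    and "s \<in> J" and "t \<in> J"
  shows "h (\<gamma> s) = h (\<gamma> t)"
proof -
  have "\<exists>c. \<forall>t\<in>J. h (\<gamma> t) = c"
  proof (rule has_field_derivative_zero_constant)
    show "convex J"
      using assms(3) by (simp add: is_interval_convex)
    show "((\<lambda>t. h (\<gamma> t)) has_real_derivative 0) (at t within J)" if "t \<in> J" for t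
      using first_integral_derivative_zero_on_integral_curve[OF assms(1,2) that]
      by (rule has_field_derivative_at_within)
  qed
  then show ?thesis
    using assms(4,5) by auto
qed

lemma integral_curve_stays_in_level_surface:
  assumes "first_integral \<Omega> F h" and "integral_curve \<Omega> F J \<gamma>" and "is_interval J"
    and "s \<in> J" and "t \<in> J" and "\<gamma> s \<in> level_surface \<Omega> h c"
  shows "\<gamma> t \<in> level_surface \<Omega> h c"
  using first_integral_constant_on_integral_curve[OF assms(1-5)] assms(2,5,6)
  by (auto simp: level_surface_def integral_curve_def)

theorem corollary4p1:
  fixes \<Omega> :: "(real^3) set"
    and F :: "real^3 \<Rightarrow> real^3"
    and h\<^sub>1 h\<^sub>2 :: "real^3 \<Rightarrow> real"
    and J :: "real^3 \<Rightarrow> real set"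
    and \<Phi> :: "real \<Rightarrow> real^3 \<Rightarrow> real^3"
    and w\<^sub>0 :: "real^3"
  assumes "open \<Omega>"
    and "first_integral \<Omega> F h\<^sub>1"
    and "first_integral \<Omega> F h\<^sub>2"
    and "transversal_intersections \<Omega> h\<^sub>1 h\<^sub>2"
    and "local_flow \<Omega> F J \<Phi>"
    and "w\<^sub>0 \<in> \<Omega>"
  shows "\<forall>w\<^sub>1 \<in> level_surface \<Omega> h\<^sub>1 (h\<^sub>1 w\<^sub>0) \<inter> level_surface \<Omega> h\<^sub>2 (h\<^sub>2 w\<^sub>0).
           \<exists>I. open_interval I \<and> 0 \<in> I \<and> I \<subseteq> J w\<^sub>1 \<and>
               {\<Phi> t w\<^sub>1 | t. t \<in> I} \<subseteq>
                 level_surface \<Omega> h\<^sub>1 (h\<^sub>1 w\<^sub>0) \<inter> level_surface \<Omega> h\<^sub>2 (h\<^sub>2 w\<^sub>0)"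
proof
  fix w\<^sub>1
  let ?L = "level_surface \<Omega> h\<^sub>1 (h\<^sub>1 w\<^sub>0) \<inter> level_surface \<Omega> h\<^sub>2 (h\<^sub>2 w\<^sub>0)"
  assume w1: "w\<^sub>1 \<in> ?L"
  then have "w\<^sub>1 \<in> \<Omega>"
    by (simp add: level_surface_def)
  then have J: "open_interval (J w\<^sub>1)" "0 \<in> J w\<^sub>1" "\<Phi> 0 w\<^sub>1 = w\<^sub>1"
    and curve: "integral_curve \<Omega> F (J w\<^sub>1) (\<lambda>t. \<Phi> t w\<^sub>1)"
    using assms(5) by (auto simp: local_flow_def)
  have interval: "is_interval (J w\<^sub>1)"
    using J(1) by (simp add: open_interval_def)
  have "\<Phi> t w\<^sub>1 \<in> ?L" if "t \<in> J w\<^sub>1" for t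
    using integral_curve_stays_in_level_surface[OF assms(2) curve interval J(2) that]
      integral_curve_stays_in_level_surface[OF assms(3) curve interval J(2) that] w1 J(3)
    by simp
  then show "\<exists>I. open_interval I \<and> 0 \<in> I \<and> I \<subseteq> J w\<^sub>1 \<and> {\<Phi> t w\<^sub>1 | t. t \<in> I} \<subseteq> ?L"
    using J by blast
qed

end
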